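(* Let $V$ be a real vector space and let $\alpha,\tilde\alpha:V\to\mathbb R$ be even functions (i.e. $\alpha(-v)=\alpha(v)$ and $\tilde\alpha(-v)=\tilde\alpha(v)$ for all $v\in V$) which do not vanish on $V\setminus 0$. Let $\beta,\tilde\beta$ be linear functionals on $V$, and let $\phi:(-b_0,b_0)\to\mathbb R$ be a positive smooth function that has nowhere zero derivative. Assume that $\tfrac{\beta(v)}{\alpha(v)},\tfrac{\tilde\beta(v)}{\tilde\alpha(v)}\in(-b_0,b_0)$ for all $v\in V\setminus0$. If $$\alpha(v)\,\phi\Big(\frac{\beta(v)}{\alpha(v)}\Big)=\tilde\alpha(v)\,\phi\Big(\frac{\tilde\beta(v)}{\tilde\alpha(v)}\Big)\quad\text{for all }v\in V\setminus 0,$$ then $\alpha=\tilde\alpha$ on $V\setminus 0$ and $\beta=\tilde\beta$.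
   Context: Here $b_0>0$. *)

theory Defs
  imports "HOL-Analysis.Analysis"
begin

(* Meant for open S, where the iterates of deriv at a point of S depend only on the
   values of f on S. *)
definition smooth_on :: "(real \<Rightarrow> real) \<Rightarrow> real set \<Rightarrow> bool" where
  "smooth_on f S \<longleftrightarrow> (\<forall>n. \<forall>x\<in>S. (deriv ^^ n) f differentiable (at x))"

end

theory Submission
  imports Defs
begin

text \<open>
  Write \<open>s = \<beta> v / \<alpha> v\<close> and \<open>t = \<beta>' v / \<alpha>' v\<close> for a fixed \<open>v \<noteq> 0\<close>. Since
  \<open>\<alpha>, \<alpha>'\<close> are even and \<open>\<beta>, \<beta>'\<close> are odd, passing from \<open>v\<close> to \<open>- v\<close> keeps the
  factors \<open>\<alpha> v, \<alpha>' v\<close> and reflects both arguments of \<open>\<phi>\<close>. The hypothesis at \<open>v\<close> and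
  at \<open>- v\<close> therefore gives \<open>\<alpha> v * \<phi> s = \<alpha>' v * \<phi> t\<close> and
  \<open>\<alpha> v * \<phi> (- s) = \<alpha>' v * \<phi> (- t)\<close>, and dividing eliminates the factors:
  \<open>\<phi> s / \<phi> (- s) = \<phi> t / \<phi> (- t)\<close>. A positive strictly monotone \<open>\<phi>\<close> makes
  the quotient \<open>\<phi> x / \<phi> (- x)\<close> strictly monotone as well, because numerator and
  denominator move in opposite directions; hence \<open>s = t\<close>
  (\<open>reflection_ratio_injective\<close>). Cancelling \<open>\<phi> s > 0\<close> then gives
  \<open>\<alpha> v = \<alpha>' v\<close>, and \<open>s = t\<close> becomes \<open>\<beta> v = \<beta>' v\<close>. Strict monotonicity of \<open>\<phi>\<close>
  is the content of \<open>strict_monotone_if_deriv_nonzero\<close>.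
\<close>

text \<open>
  By Rolle's theorem a function whose derivative never vanishes is injective, and a
  continuous injective function on an interval is strictly monotone.
\<close>

lemma strict_monotone_if_deriv_nonzero:
  fixes f :: "real \<Rightarrow> real"
  assumes S: "is_interval S"
    and diff: "\<And>x. x \<in> S \<Longrightarrow> f differentiable (at x)"
    and nonzero: "\<And>x. x \<in> S \<Longrightarrow> deriv f x \<noteq> 0"
  shows "strict_mono_on S f \<or> strict_antimono_on S f"
proof -
  have cont: "continuous_on S f"
    by (intro continuous_at_imp_continuous_on ballI differentiable_imp_continuous_within diff)
  have neq: "f a \<noteq> f b" if ab: "a \<in> S" "b \<in> S" "a < b" for a b
  proof
    assume eq: "f a = f b"
    have sub: "{a..b} \<subseteq> S"
      using mem_is_interval_1_I[OF S ab(1,2)] by auto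
    have "\<exists>l z. a < z \<and> z < b \<and> DERIV f z :> l \<and> f b - f a = (b - a) * l"
    proof (rule MVT)
      show "continuous_on {a..b} f"
        by (rule continuous_on_subset[OF cont sub])
      show "f differentiable (at x)" if "a < x" "x < b" for x
        using sub that by (intro diff) auto
    qed (rule ab(3))
    then obtain z where z: "a < z" "z < b" and "DERIV f z :> 0"
      using eq ab by auto
    then have "deriv f z = 0"
      by (simp add: DERIV_imp_deriv)
    moreover have "z \<in> S"
      using sub z by auto
    ultimately show False
      using nonzero by blast
  qed
  have "inj_on f S"
    by (rule linorder_inj_onI) (simp_all add: neq linear)
  then show ?thesis
    by (simp only: injective_eq_monotone_map[OF S cont])
qed

text \<open>
  This is injectivity of \<open>x \<mapsto> f x / f (- x)\<close>, with the denominators cleared: if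
  \<open>s < t\<close>, then \<open>- t < - s\<close>, so passing from the left product to the right one
  moves both positive factors strictly in the same direction.
\<close>

lemma reflection_ratio_injective:
  fixes f :: "real \<Rightarrow> real"
  assumes mono: "strict_mono_on S f \<or> strict_antimono_on S f"
    and pos: "\<And>x. x \<in> S \<Longrightarrow> f x > 0"
    and sym: "\<And>x. x \<in> S \<Longrightarrow> - x \<in> S"
    and s: "s \<in> S" and t: "t \<in> S"
    and eq: "f s * f (- t) = f t * f (- s)"
  shows "s = t"
proof -
  have neq: "f x * f (- y) \<noteq> f y * f (- x)" if xy: "x \<in> S" "y \<in> S" "x < y" for x y
    using mono
  proof
    assume "strict_mono_on S f"
    then have "f x < f y" "f (- y) < f (- x)"
      using xy sym by (auto simp: strict_mono_on_def)
    then have "f x * f (- y) < f y * f (- x)"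
      using pos xy sym by (intro mult_strict_mono) (auto intro: less_imp_le)
    then show ?thesis by simp
  next
    assume "strict_antimono_on S f"
    then have "f y < f x" "f (- x) < f (- y)"
      using xy sym by (auto simp: monotone_on_def)
    then have "f y * f (- x) < f x * f (- y)"
      using pos xy sym by (intro mult_strict_mono) (auto intro: less_imp_le)
    then show ?thesis by simp
  qed
  show ?thesis
    using neq[OF s t] neq[OF t s] eq by (metis linorder_neqE_linordered_idom)
qed

theorem proposition3p3:
  fixes \<alpha> \<alpha>' \<beta> \<beta>' :: "'v::real_vector \<Rightarrow> real"
    and \<phi> :: "real \<Rightarrow> real"
    and b\<^sub>0 :: real
  assumes "b\<^sub>0 > 0"
    and "\<And>v. \<alpha> (- v) = \<alpha> v"
    and "\<And>v. \<alpha>' (- v) = \<alpha>' v"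
    and "\<And>v. v \<noteq> 0 \<Longrightarrow> \<alpha> v \<noteq> 0"
    and "\<And>v. v \<noteq> 0 \<Longrightarrow> \<alpha>' v \<noteq> 0"
    and "linear \<beta>"
    and "linear \<beta>'"
    and "\<And>x. x \<in> {- b\<^sub>0<..<b\<^sub>0} \<Longrightarrow> \<phi> x > 0"
    and "smooth_on \<phi> {- b\<^sub>0<..<b\<^sub>0}"
    and "\<And>x. x \<in> {- b\<^sub>0<..<b\<^sub>0} \<Longrightarrow> deriv \<phi> x \<noteq> 0"
    and "\<And>v. v \<noteq> 0 \<Longrightarrow> \<beta> v / \<alpha> v \<in> {- b\<^sub>0<..<b\<^sub>0}"
    and "\<And>v. v \<noteq> 0 \<Longrightarrow> \<beta>' v / \<alpha>' v \<in> {- b\<^sub>0<..<b\<^sub>0}"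
    and "\<And>v. v \<noteq> 0 \<Longrightarrow> \<alpha> v * \<phi> (\<beta> v / \<alpha> v) = \<alpha>' v * \<phi> (\<beta>' v / \<alpha>' v)"
  shows "(\<forall>v. v \<noteq> 0 \<longrightarrow> \<alpha> v = \<alpha>' v) \<and> \<beta> = \<beta>'"
proof -
  let ?S = "{- b\<^sub>0<..<b\<^sub>0}"
  note even = assms(2,3) and nonzero = assms(4,5) and lin = assms(6,7)
    and pos = assms(8) and range = assms(11,12) and eq = assms(13)
  have diff: "\<phi> differentiable (at x)" if "x \<in> ?S" for x
  proof -
    have "(deriv ^^ 0) \<phi> differentiable (at x)"
      using assms(9) that unfolding smooth_on_def by blast
    then show ?thesis by simp
  qed
  have mono: "strict_mono_on ?S \<phi> \<or> strict_antimono_on ?S \<phi>"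
    using diff assms(10) by (intro strict_monotone_if_deriv_nonzero) (auto simp: is_interval_1)
  have agree: "\<alpha> v = \<alpha>' v \<and> \<beta> v = \<beta>' v" if v: "v \<noteq> 0" for v
  proof -
    let ?s = "\<beta> v / \<alpha> v" and ?t = "\<beta>' v / \<alpha>' v"
    have at_v: "\<alpha> v * \<phi> ?s = \<alpha>' v * \<phi> ?t"
      using eq v by blast
    have at_neg_v: "\<alpha> v * \<phi> (- ?s) = \<alpha>' v * \<phi> (- ?t)"
      using eq[of "- v"] v by (simp add: even linear_neg[OF lin(1)] linear_neg[OF lin(2)])
    have "(\<alpha> v * \<phi> ?s) * (\<alpha>' v * \<phi> (- ?t)) = (\<alpha>' v * \<phi> ?t) * (\<alpha> v * \<phi> (- ?s))"
      by (simp only: at_v at_neg_v)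
    then have "(\<alpha> v * \<alpha>' v) * (\<phi> ?s * \<phi> (- ?t)) = (\<alpha> v * \<alpha>' v) * (\<phi> ?t * \<phi> (- ?s))"
      by (simp only: mult_ac)
    then have ratio: "\<phi> ?s * \<phi> (- ?t) = \<phi> ?t * \<phi> (- ?s)"
      using nonzero v by simp
    have st: "?s = ?t"
      by (rule reflection_ratio_injective[OF mono pos _ range(1)[OF v] range(2)[OF v] ratio]) auto
    moreover have "\<phi> ?t \<noteq> 0"
      using pos range(2)[OF v] by force
    ultimately have "\<alpha> v = \<alpha>' v"
      using at_v by simp
    then show ?thesis
      using st nonzero(1)[OF v] by simp
  qed
  have "\<beta> v = \<beta>' v" for v
    using agree linear_0[OF lin(1)] linear_0[OF lin(2)] by (cases "v = 0") auto
  then have "\<beta> = \<beta>'"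
    by (rule ext)
  then show ?thesis
    using agree by blast
qed

end
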